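(* Let $X\sim N_d(\theta,\sigma^2I_d)$ with $\theta\in\mathbb{R}^d$ unknown and $\sigma^2>0$ known. Let $\beta:[0,\infty)\to[0,\infty)$ be absolutely continuous and strictly increasing, with $\mathbb{E}\{\beta(Z)\}<\infty$ for $Z\sim\chi^2_d$. Consider estimating the first-stage loss $L=\beta\big(\frac{\|X-\theta\|^2}{\sigma^2}\big)$ (incurred by the estimator $\hat\theta_0(X)=X$ of $\theta$) under the second-stage loss $\rho_j\big(\frac{\hat L}{L}\big)$, $j\in\{A,B,C\}$, where $$\rho_A(t)=(t^m-1)^2\ \ (m\neq0),\qquad \rho_B(t)=\tfrac12\Big(t+\frac1t-2\Big),\qquad \rho_C(t)=(\log t)^2 .$$ For each $j\in\{A,B,C\}$, let $\hat L_{\pi_0,j}(X)$ be the generalized Bayes estimator of $L$ under second-stage loss $\rho_j\big(\frac{\hat L}{L}\big)$ with respect to the uniform prior density $\pi_0(\theta)=1$ on $\mathbb{R}^d$, and assume that it exists and has finite risk. Then $\hat L_{\pi_0,j}(X)$ is minimax, its frequentist risk is constant in $\theta$, and this constant equals the minimax risk.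
   Context: An estimator of $L$ is a function $\hat L(X)$ of $X$ with values in $(0,\infty)$. Its frequentist risk under second-stage loss $\rho_j$ is $R(\theta,\hat L)=\mathbb{E}_\theta\big(\rho_j(\hat L(X)/L)\big)$, where $L=L(\theta,X)$ also depends on $X$. An estimator $\hat L_m(X)$ is minimax if $\sup_{\theta}R(\theta,\hat L_m)=\inf_{\hat L}\sup_{\theta}R(\theta,\hat L)$; this common value is the minimax risk. $\chi^2_d$ is the central chi-square distribution with $d$ degrees of freedom. The generalized Bayes estimator $\hat L_{\pi_0,j}(x)$ minimizes over $\hat L>0$ the posterior expected loss $\mathbb{E}\big(\rho_j(\hat L/L)\,|\,x\big)$, where under $\pi_0$ the posterior distribution is $\theta|x\sim N_d(x,\sigma^2I_d)$. *)

theory Defs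
  imports "HOL-Probability.Probability"
begin

section \<open>Distributions\<close>

(* The density of N_d(\<theta>, \<sigma>^2 I_d): the coordinates are independent N(\<theta>_i, \<sigma>^2).
   The parameter \<sigma> is the standard deviation, as in normal_density. *)
definition mvn_density :: "real ^ 'n \<Rightarrow> real \<Rightarrow> real ^ 'n \<Rightarrow> real" where
  "mvn_density \<theta> \<sigma> x = (\<Prod>i\<in>UNIV. normal_density (\<theta> $ i) \<sigma> (x $ i))"

definition mvn :: "real ^ 'n \<Rightarrow> real \<Rightarrow> (real ^ 'n) measure" where
  "mvn \<theta> \<sigma> = density lborel (\<lambda>x. ennreal (mvn_density \<theta> \<sigma> x))"

definition chi_square :: "nat \<Rightarrow> real measure" where
  "chi_square d =
     distr (\<Pi>\<^sub>M i\<in>{..<d}. density lborel (\<lambda>z. ennreal (std_normal_density z))) borel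
       (\<lambda>z. \<Sum>i<d. (z i)\<^sup>2)"


section \<open>Absolutely continuous functions\<close>

definition abs_cont_on :: "real \<Rightarrow> real \<Rightarrow> (real \<Rightarrow> real) \<Rightarrow> bool" where
  "abs_cont_on a b f \<longleftrightarrow>
     (\<forall>\<epsilon>>0. \<exists>\<delta>>0. \<forall>(N::nat) u v.
        (\<forall>i<N. a \<le> u i \<and> u i \<le> v i \<and> v i \<le> b) \<and>
        disjoint_family_on (\<lambda>i. {u i<..<v i}) {..<N} \<and>
        (\<Sum>i<N. v i - u i) < \<delta> \<longrightarrow>
        (\<Sum>i<N. \<bar>f (v i) - f (u i)\<bar>) < \<epsilon>)"

(* On the unbounded interval [0, \<infinity>) absolute continuity is understood on every compact
   subinterval; the uniform version would exclude functions such as t^2. *)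
definition abs_cont_halfline :: "(real \<Rightarrow> real) \<Rightarrow> bool" where
  "abs_cont_halfline f \<longleftrightarrow> (\<forall>b\<ge>0. abs_cont_on 0 b f)"


section \<open>First-stage and second-stage losses\<close>

definition first_loss :: "real \<Rightarrow> (real \<Rightarrow> real) \<Rightarrow> real ^ 'n \<Rightarrow> real ^ 'n \<Rightarrow> real" where
  "first_loss \<sigma> \<beta> \<theta> x = \<beta> ((norm (x - \<theta>))\<^sup>2 / \<sigma>\<^sup>2)"

definition rho_A :: "real \<Rightarrow> real \<Rightarrow> real" where
  "rho_A m t = (t powr m - 1)\<^sup>2"

definition rho_B :: "real \<Rightarrow> real" where
  "rho_B t = (t + 1 / t - 2) / 2"

definition rho_C :: "real \<Rightarrow> real" where
  "rho_C t = (ln t)\<^sup>2"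


section \<open>Estimators, risk and minimaxity\<close>

definition estimators :: "(real ^ 'n \<Rightarrow> real) set" where
  "estimators = {\<delta>. \<delta> \<in> borel_measurable borel \<and> (\<forall>x. \<delta> x > 0)}"

(* The second-stage losses are nonnegative, so every risk exists in [0, \<infinity>].  If \<beta> 0 = 0, the
   ratio is undefined only at x = \<theta>, which is a null event. *)
definition risk ::
  "real \<Rightarrow> (real \<Rightarrow> real) \<Rightarrow> (real \<Rightarrow> real) \<Rightarrow> real ^ 'n \<Rightarrow> (real ^ 'n \<Rightarrow> real) \<Rightarrow> ennreal" where
  "risk \<sigma> \<beta> \<rho> \<theta> \<delta> = (\<integral>\<^sup>+ x. ennreal (\<rho> (\<delta> x / first_loss \<sigma> \<beta> \<theta> x)) \<partial>mvn \<theta> \<sigma>)"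

definition sup_risk ::
  "real \<Rightarrow> (real \<Rightarrow> real) \<Rightarrow> (real \<Rightarrow> real) \<Rightarrow> (real ^ 'n \<Rightarrow> real) \<Rightarrow> ennreal" where
  "sup_risk \<sigma> \<beta> \<rho> \<delta> = (SUP \<theta>. risk \<sigma> \<beta> \<rho> \<theta> \<delta>)"

(* The type argument fixes the dimension of the observation. *)
definition minimax_risk ::
  "'n::finite itself \<Rightarrow> real \<Rightarrow> (real \<Rightarrow> real) \<Rightarrow> (real \<Rightarrow> real) \<Rightarrow> ennreal" where
  "minimax_risk TYPE('n) \<sigma> \<beta> \<rho> =
     (INF \<delta> \<in> (estimators :: (real ^ 'n \<Rightarrow> real) set). sup_risk \<sigma> \<beta> \<rho> \<delta>)"

definition minimax ::
  "real \<Rightarrow> (real \<Rightarrow> real) \<Rightarrow> (real \<Rightarrow> real) \<Rightarrow> (real ^ 'n::finite \<Rightarrow> real) \<Rightarrow> bool" where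
  "minimax \<sigma> \<beta> \<rho> \<delta> \<longleftrightarrow>
     \<delta> \<in> estimators \<and> sup_risk \<sigma> \<beta> \<rho> \<delta> = minimax_risk TYPE('n) \<sigma> \<beta> \<rho>"


section \<open>Generalized Bayes estimators\<close>

definition posterior ::
  "real \<Rightarrow> (real ^ 'n \<Rightarrow> real) \<Rightarrow> real ^ 'n \<Rightarrow> (real ^ 'n) measure" where
  "posterior \<sigma> \<pi>\<^sub>0 x =
     density lborel (\<lambda>\<theta>. ennreal (mvn_density \<theta> \<sigma> x * \<pi>\<^sub>0 \<theta>) /
       (\<integral>\<^sup>+ t. ennreal (mvn_density t \<sigma> x * \<pi>\<^sub>0 t) \<partial>lborel))"

definition posterior_loss ::
  "real \<Rightarrow> (real \<Rightarrow> real) \<Rightarrow> (real \<Rightarrow> real) \<Rightarrow> (real ^ 'n \<Rightarrow> real) \<Rightarrow> real ^ 'n \<Rightarrow> real \<Rightarrow> ennreal"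
where
  "posterior_loss \<sigma> \<beta> \<rho> \<pi>\<^sub>0 x a =
     (\<integral>\<^sup>+ \<theta>. ennreal (\<rho> (a / first_loss \<sigma> \<beta> \<theta> x)) \<partial>posterior \<sigma> \<pi>\<^sub>0 x)"

(* The minimal posterior expected loss has to be finite: if it were identically \<infinity>, every
   estimator would be a minimizer in the extended reals. *)
definition generalized_Bayes ::
  "real \<Rightarrow> (real \<Rightarrow> real) \<Rightarrow> (real \<Rightarrow> real) \<Rightarrow> (real ^ 'n \<Rightarrow> real) \<Rightarrow> (real ^ 'n \<Rightarrow> real) \<Rightarrow> bool"
where
  "generalized_Bayes \<sigma> \<beta> \<rho> \<pi>\<^sub>0 \<delta> \<longleftrightarrow>
     \<delta> \<in> estimators \<and>
     (\<forall>x. posterior_loss \<sigma> \<beta> \<rho> \<pi>\<^sub>0 x (\<delta> x) < \<infinity> \<and>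
          (\<forall>a>0. posterior_loss \<sigma> \<beta> \<rho> \<pi>\<^sub>0 x (\<delta> x) \<le> posterior_loss \<sigma> \<beta> \<rho> \<pi>\<^sub>0 x a))"


section \<open>The posterior under the uniform prior\<close>

lemma mvn_density_commute: "mvn_density \<theta> \<sigma> x = mvn_density x \<sigma> \<theta>"
  by (simp add: mvn_density_def normal_density_def power2_commute)

lemma nn_integral_mvn_density:
  fixes \<theta> :: "real ^ 'n"
  assumes "\<sigma> > 0"
  shows "(\<integral>\<^sup>+ x. ennreal (mvn_density \<theta> \<sigma> x) \<partial>lborel) = 1"
proof -
  have inj: "inj (\<lambda>i::'n. axis i (1::real))"
    by (auto simp: inj_on_def axis_eq_axis)
  have Basis_eq: "(Basis :: (real ^ 'n) set) = range (\<lambda>i. axis i 1)"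
    by (auto simp: Basis_vec_def)
  have one: "(\<integral>\<^sup>+ z. ennreal (normal_density \<mu> \<sigma> z) \<partial>lborel) = 1" for \<mu>
    using assms by (simp add: nn_integral_eq_integral)
  have "(\<integral>\<^sup>+ x. ennreal (mvn_density \<theta> \<sigma> x) \<partial>lborel) =
      (\<integral>\<^sup>+ x. (\<Prod>b\<in>Basis. ennreal (normal_density (\<theta> \<bullet> b) \<sigma> (x \<bullet> b))) \<partial>lborel)"
    by (simp add: mvn_density_def Basis_eq prod.reindex[OF inj] inner_axis prod_ennreal)
  also have "\<dots> = (\<Prod>b\<in>Basis. \<integral>\<^sup>+ z. ennreal (normal_density (\<theta> \<bullet> b) \<sigma> z) \<partial>lborel)"
    by (rule nn_integral_lborel_prod) auto
  finally show ?thesis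
    by (simp add: one)
qed

lemma posterior_uniform:
  assumes "\<sigma> > 0"
  shows "posterior \<sigma> (\<lambda>_. 1) x = mvn x \<sigma>"
  using nn_integral_mvn_density[OF assms, of x]
  by (simp add: posterior_def mvn_def mvn_density_commute[of _ \<sigma> x] divide_ennreal_def)

end

theory Submission
  imports Defs "HOL-Real_Asymp.Real_Asymp"
begin

text \<open>
  The problem is invariant under translations of \<open>(\<theta>, x)\<close>: the loss to be estimated is a
  function \<open>W\<close> of the pivot \<open>z = x - \<theta>\<close>, whose law is \<open>N(0, \<sigma>\<^sup>2 I)\<close> both under the
  sampling distribution and, by symmetry, under the posterior for the uniform prior. Hence the
  posterior expected loss of a value \<open>a\<close> is the same function \<open>h(a) = E \<rho>(a / W(z))\<close> at every \<open>x\<close>,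
  and \<open>h(a)\<close> is also the risk, at every \<open>\<theta>\<close>, of the estimator that always reports \<open>a\<close>. Each of
  the three losses is strictly convex in a suitable coordinate (\<open>t\<^sup>m\<close>, \<open>t\<close> and \<open>ln t\<close>
  respectively), so a finite minimum of \<open>h\<close> is attained at one point only (\<open>unique_minimizer\<close>).
  The generalized Bayes estimator is therefore a constant \<open>a\<close>, with constant risk \<open>h(a) = min h\<close>.

  It remains to see that no estimator has supremum risk \<open>s\<close> below \<open>h(a)\<close>. Give \<open>\<theta>\<close> the uniform
  distribution on a ball of radius \<open>R + M\<close>. Whenever \<open>x\<close> lies in the ball of radius \<open>R\<close>, all \<open>\<theta>\<close>
  within distance \<open>M\<close> of \<open>x\<close> are covered by this prior, so the estimate at \<open>x\<close> costs at least the
  infimum of \<open>h\<^sub>M(b) = E (\<rho>(b / W(z)); \<bar>z\<bar> < M)\<close>. As \<open>R\<close> grows, the two volumes become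
  proportionally equal, whence \<open>inf h\<^sub>M \<le> s\<close> for every \<open>M\<close> (\<open>truncated_Bayes_bound\<close>).

  To let \<open>M\<close> grow as well, take near-minimizers \<open>b\<^sub>M\<close> of \<open>h\<^sub>M\<close>. They have a limit point \<open>b\<close> in the
  compact interval \<open>[0, \<infinity>]\<close>, and Fatou's lemma gives \<open>h(b) \<le> s\<close>, where \<open>h\<close> at an endpoint means
  the limit of \<open>\<rho>\<close> there (\<open>truncated_minimizers_limit\<close>). These endpoint limits are infinite, except
  that \<open>\<rho>\<^sub>A\<close> tends to \<open>1\<close> at one end; convexity shows that even this value is at least
  \<open>min h\<close>. In all cases \<open>h(a) \<le> s\<close>.
\<close>

section \<open>The first-stage loss as a function of the pivot\<close>

lemma beta_positive:
  fixes \<beta> :: "real \<Rightarrow> real"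
  assumes nonneg: "\<And>t. t \<ge> 0 \<Longrightarrow> \<beta> t \<ge> 0" and mono: "strict_mono_on {0..} \<beta>" and "t > 0"
  shows "\<beta> t > 0"
  using nonneg[of 0] strict_mono_onD[OF mono, of 0 t] assms(3) by auto

lemma borel_measurable_loss_of_norm:
  fixes \<beta> :: "real \<Rightarrow> real"
  assumes mono: "strict_mono_on {0..} \<beta>"
  shows "(\<lambda>z::real^'n. \<beta> ((norm z)\<^sup>2 / \<sigma>\<^sup>2)) \<in> borel_measurable borel"
proof -
  \<comment> \<open>Nothing is known about \<open>\<beta>\<close> on the negative axis, so it is made constant there.\<close>
  have "mono (\<lambda>t. \<beta> (max 0 t))"
    by (intro monoI strict_mono_on_leD[OF mono]) auto
  then have [measurable]: "(\<lambda>t. \<beta> (max 0 t)) \<in> borel_measurable borel"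
    by (rule borel_measurable_mono)
  have "(\<lambda>z::real^'n. (\<lambda>t. \<beta> (max 0 t)) ((norm z)\<^sup>2 / \<sigma>\<^sup>2)) \<in> borel_measurable borel"
    by measurable
  then show ?thesis by (simp add: max_def)
qed

section \<open>Translation invariance of the normal model\<close>

lemma mvn_density_translate: "mvn_density \<theta> \<sigma> x = mvn_density 0 \<sigma> (x - \<theta>)"
  by (simp add: mvn_density_def normal_density_def)

lemma borel_measurable_mvn_density [measurable]:
  "mvn_density \<theta> \<sigma> \<in> borel_measurable borel"
  unfolding mvn_density_def by measurable

lemma sets_mvn [measurable_cong]: "sets (mvn \<theta> \<sigma>) = sets borel"
  by (simp add: mvn_def)

lemma nn_integral_mvn:
  assumes [measurable]: "f \<in> borel_measurable borel"
  shows "(\<integral>\<^sup>+ x. f x \<partial>mvn \<theta> \<sigma>) = (\<integral>\<^sup>+ x. ennreal (mvn_density \<theta> \<sigma> x) * f x \<partial>lborel)"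
  unfolding mvn_def by (subst nn_integral_density) auto

lemma nn_integral_lborel_translate:
  fixes c :: "'a::euclidean_space"
  assumes [measurable]: "f \<in> borel_measurable borel"
  shows "(\<integral>\<^sup>+ x. f (x - c) \<partial>lborel) = (\<integral>\<^sup>+ x. f x \<partial>lborel)"
proof -
  have "(\<integral>\<^sup>+ x. f x \<partial>lborel) = (\<integral>\<^sup>+ x. f x \<partial>distr lborel borel ((+) (- c)))"
    by (simp add: lborel_distr_plus)
  also have "\<dots> = (\<integral>\<^sup>+ x. f (x - c) \<partial>lborel)"
    by (subst nn_integral_distr) auto
  finally show ?thesis by simp
qed

lemma nn_integral_mvn_translate:
  assumes [measurable]: "f \<in> borel_measurable borel"
  shows "(\<integral>\<^sup>+ x. f (x - \<theta>) \<partial>mvn \<theta> \<sigma>) = (\<integral>\<^sup>+ z. f z \<partial>mvn 0 \<sigma>)"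
proof -
  have "(\<integral>\<^sup>+ x. f (x - \<theta>) \<partial>mvn \<theta> \<sigma>) =
      (\<integral>\<^sup>+ x. (\<lambda>z. ennreal (mvn_density 0 \<sigma> z) * f z) (x - \<theta>) \<partial>lborel)"
    by (simp add: nn_integral_mvn mvn_density_translate[of \<theta>])
  also have "\<dots> = (\<integral>\<^sup>+ z. f z \<partial>mvn 0 \<sigma>)"
    by (subst nn_integral_lborel_translate) (auto simp: nn_integral_mvn)
  finally show ?thesis .
qed

lemma prob_space_mvn: "\<sigma> > 0 \<Longrightarrow> prob_space (mvn \<theta> \<sigma>)"
  by (rule prob_spaceI) (simp add: mvn_def emeasure_density nn_integral_mvn_density)

lemma AE_mvn_nonzero: "AE z in mvn \<theta> \<sigma>. z \<noteq> 0"
proof -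
  have "AE z in lborel. z \<noteq> (0::real^'n)"
    by (rule AE_lborel_singleton)
  then show ?thesis
    unfolding mvn_def by (subst AE_density) auto
qed

lemma AE_loss_positive:
  fixes \<beta> :: "real \<Rightarrow> real"
  assumes "\<sigma> > 0" and nonneg: "\<And>t. t \<ge> 0 \<Longrightarrow> \<beta> t \<ge> 0" and mono: "strict_mono_on {0..} \<beta>"
  shows "AE z in mvn \<theta> \<sigma>. \<beta> ((norm z)\<^sup>2 / \<sigma>\<^sup>2) > 0"
  using AE_mvn_nonzero[of \<theta> \<sigma>]
proof eventually_elim
  case (elim z)
  then show ?case
    using assms(1) by (intro beta_positive[OF nonneg mono]) auto
qed

lemma risk_constant_estimator:
  fixes \<theta> :: "real^'n"
  assumes "strict_mono_on {0..} \<beta>" and [measurable]: "\<rho> \<in> borel_measurable borel"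
  shows "risk \<sigma> \<beta> \<rho> \<theta> (\<lambda>_. a) = risk \<sigma> \<beta> \<rho> (0 :: real^'n) (\<lambda>_. a)"
proof -
  note [measurable] = borel_measurable_loss_of_norm[OF assms(1)]
  show ?thesis
    unfolding risk_def first_loss_def
    using nn_integral_mvn_translate[of "\<lambda>z. ennreal (\<rho> (a / \<beta> ((norm z)\<^sup>2 / \<sigma>\<^sup>2)))" \<theta> \<sigma>]
    by simp
qed

text \<open>The density is symmetric in \<open>x\<close> and \<open>\<theta>\<close>, so averaging over \<open>\<theta>\<close> around a fixed \<open>x\<close> is
  the same as averaging over \<open>x\<close> around a fixed \<open>\<theta>\<close>. This identifies the posterior criterion with
  a frequentist risk.\<close>
lemma posterior_loss_uniform:
  fixes x :: "real^'n"
  assumes "\<sigma> > 0" "strict_mono_on {0..} \<beta>" and [measurable]: "\<rho> \<in> borel_measurable borel"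
  shows "posterior_loss \<sigma> \<beta> \<rho> (\<lambda>_. 1) x a = risk \<sigma> \<beta> \<rho> (0 :: real^'n) (\<lambda>_. a)"
  unfolding posterior_loss_def posterior_uniform[OF assms(1)]
    risk_constant_estimator[OF assms(2,3), of \<sigma> x a, symmetric]
  by (simp add: risk_def first_loss_def norm_minus_commute)

section \<open>Uniqueness of the Bayes value\<close>

text \<open>The hypothesis on \<open>\<rho>\<close> is strict midpoint convexity in an unspecified coordinate of the
  estimate: \<open>c\<close> is the midpoint of \<open>a\<close> and \<open>b\<close> in that coordinate, and must not depend on the
  unknown loss \<open>w\<close>. It then beats the average of two distinct minimizers strictly after integration,
  the finiteness of the minimum being what makes the strict inequality survive.\<close>
lemma unique_minimizer:
  fixes \<beta> \<rho> :: "real \<Rightarrow> real" and \<sigma> :: real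
  defines "h \<equiv> \<lambda>a. risk \<sigma> \<beta> \<rho> (0 :: real^'n::finite) (\<lambda>_. a)"
  assumes \<sigma>: "\<sigma> > 0" and nonneg: "\<And>t. t \<ge> 0 \<Longrightarrow> \<beta> t \<ge> 0" and mono: "strict_mono_on {0..} \<beta>"
    and meas [measurable]: "\<rho> \<in> borel_measurable borel" and \<rho>: "\<And>t. t > 0 \<Longrightarrow> \<rho> t \<ge> 0"
    and mid: "\<And>a b. a > 0 \<Longrightarrow> b > 0 \<Longrightarrow> a \<noteq> b \<Longrightarrow>
               \<exists>c>0. \<forall>w>0. 2 * \<rho> (c / w) < \<rho> (a / w) + \<rho> (b / w)"
    and ab: "a > 0" "b > 0" and fin: "h a < \<infinity>"
    and min: "\<And>c. c > 0 \<Longrightarrow> h a \<le> h c" "\<And>c. c > 0 \<Longrightarrow> h b \<le> h c"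
  shows "a = b"
proof (rule ccontr)
  assume "a \<noteq> b"
  then obtain c where c: "c > 0" "\<And>w. w > 0 \<Longrightarrow> 2 * \<rho> (c / w) < \<rho> (a / w) + \<rho> (b / w)"
    using mid ab by blast
  define Q :: "(real^'n) measure" where "Q = mvn 0 \<sigma>"
  define W where "W = (\<lambda>z::real^'n. \<beta> ((norm z)\<^sup>2 / \<sigma>\<^sup>2))"
  interpret prob_space Q unfolding Q_def by (rule prob_space_mvn[OF \<sigma>])
  have [measurable_cong]: "sets Q = sets borel" by (simp add: Q_def sets_mvn)
  have [measurable]: "W \<in> borel_measurable borel"
    unfolding W_def by (rule borel_measurable_loss_of_norm[OF mono])
  have h: "h e = (\<integral>\<^sup>+ z. ennreal (\<rho> (e / W z)) \<partial>Q)" for e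
    by (simp add: h_def risk_def first_loss_def Q_def W_def)
  have Wpos: "AE z in Q. W z > 0"
    unfolding Q_def W_def by (rule AE_loss_positive[OF \<sigma> nonneg mono])
  have hab: "h a = h b" using min ab by (metis order_antisym)
  have sum: "h a + h b = (\<integral>\<^sup>+ z. ennreal (\<rho> (a / W z)) + ennreal (\<rho> (b / W z)) \<partial>Q)"
    unfolding h by (rule nn_integral_add[symmetric]) auto
  have twice: "2 * h c = (\<integral>\<^sup>+ z. 2 * ennreal (\<rho> (c / W z)) \<partial>Q)"
    unfolding h by (rule nn_integral_cmult[symmetric]) auto
  have le: "AE z in Q. 2 * ennreal (\<rho> (c / W z)) < ennreal (\<rho> (a / W z)) + ennreal (\<rho> (b / W z))"
    using Wpos
  proof eventually_elim
    case (elim z)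
    have "2 * ennreal (\<rho> (c / W z)) = ennreal (2 * \<rho> (c / W z))"
      using \<rho>[of "c / W z"] c(1) elim by (simp add: ennreal_mult)
    also have "\<dots> < ennreal (\<rho> (a / W z) + \<rho> (b / W z))"
      using c(2)[OF elim] \<rho>[of "c / W z"] c(1) elim by (intro ennreal_lessI) (auto intro: order_le_less_trans)
    finally show ?case using \<rho> ab elim by simp
  qed
  have fin2: "2 * h c \<noteq> \<infinity>"
  proof -
    have "2 * h c \<le> h a + h b" unfolding sum twice
      by (rule nn_integral_mono_AE) (use le in eventually_elim, auto)
    then show ?thesis using fin hab by (auto simp: top_unique)
  qed
  have "2 * h c < h a + h b"
    unfolding sum twice
  proof (rule nn_integral_less)
    show "(\<integral>\<^sup>+ z. 2 * ennreal (\<rho> (c / W z)) \<partial>Q) \<noteq> \<infinity>"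
      using fin2 by (simp add: twice)
    show "AE z in Q. 2 * ennreal (\<rho> (c / W z)) \<le> ennreal (\<rho> (a / W z)) + ennreal (\<rho> (b / W z))"
      using le by eventually_elim auto
    show "\<not> (AE z in Q. ennreal (\<rho> (a / W z)) + ennreal (\<rho> (b / W z)) \<le> 2 * ennreal (\<rho> (c / W z)))"
    proof
      assume "AE z in Q. ennreal (\<rho> (a / W z)) + ennreal (\<rho> (b / W z)) \<le> 2 * ennreal (\<rho> (c / W z))"
      with le have "AE z in Q. False" by eventually_elim auto
      then show False by simp
    qed
  qed auto
  also have "h a + h b \<le> 2 * h c"
    using add_mono[OF min(1)[OF c(1)] min(2)[OF c(1)]] by (simp add: mult_2)
  finally show False by simp
qed

section \<open>Removing the truncation\<close>

text \<open>The infima of the truncated problems converge to no less than the infimum of the full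
  problem over \<open>[0, \<infinity>]\<close>, on which \<open>\<rho>\<close> is extended by its limits. A limit point of near-minimizers
  exists in the compact interval, and Fatou's lemma handles the varying truncation sets and the varying
  estimates at once. As \<open>Q\<close> is a probability measure, the extended criterion takes the values \<open>c\<^sub>0\<close>
  and \<open>c\<^sub>1\<close> at the endpoints.\<close>
lemma truncated_minimizers_limit:
  fixes Q :: "'a measure" and W :: "'a \<Rightarrow> real" and \<rho> :: "real \<Rightarrow> real" and s c\<^sub>0 c\<^sub>1 :: ennreal
  assumes Q: "prob_space Q" and [measurable]: "W \<in> borel_measurable Q" "\<rho> \<in> borel_measurable borel"
    "\<And>n. S n \<in> sets Q"
    and Wpos: "AE z in Q. W z > 0" and exhaust: "AE z in Q. \<forall>\<^sub>F n in sequentially. z \<in> S n"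
    and cont: "continuous_on {0<..} \<rho>"
    and lim0: "((\<lambda>t. ennreal (\<rho> t)) \<longlongrightarrow> c\<^sub>0) (at_right 0)"
    and lim1: "((\<lambda>t. ennreal (\<rho> t)) \<longlongrightarrow> c\<^sub>1) at_top"
    and small: "\<And>n::nat. (INF a\<in>{0<..}. \<integral>\<^sup>+ z. indicator (S n) z * ennreal (\<rho> (a / W z)) \<partial>Q) \<le> s"
    and s: "s < \<infinity>"
  shows "c\<^sub>0 \<le> s \<or> c\<^sub>1 \<le> s \<or> (\<exists>a>0. (\<integral>\<^sup>+ z. ennreal (\<rho> (a / W z)) \<partial>Q) \<le> s)"
proof -
  interpret prob_space Q by fact
  have "\<exists>a>0. (\<integral>\<^sup>+ z. indicator (S n) z * ennreal (\<rho> (a / W z)) \<partial>Q) < s + ennreal (1 / Suc n)" for n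
  proof -
    have "s < s + ennreal (1 / Suc n)"
      using s by (simp add: ennreal_less_top)
    then have "(INF a\<in>{0<..}. \<integral>\<^sup>+ z. indicator (S n) z * ennreal (\<rho> (a / W z)) \<partial>Q) < s + ennreal (1 / Suc n)"
      by (rule order_le_less_trans[OF small])
    then show ?thesis unfolding INF_less_iff by auto
  qed
  then obtain a where apos: "\<And>n. a n > 0"
    and a: "\<And>n. (\<integral>\<^sup>+ z. indicator (S n) z * ennreal (\<rho> (a n / W z)) \<partial>Q) < s + ennreal (1 / Suc n)"
    by metis
  have anz: "a n \<noteq> 0" for n using apos[of n] by simp
  obtain l r where r: "strict_mono (r :: nat \<Rightarrow> nat)" and l: "(\<lambda>n. ennreal (a (r n))) \<longlonglongrightarrow> l"
    using compact_complete_linorder[of "\<lambda>n. ennreal (a n)"] unfolding o_def by blast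
  have r_top: "filterlim r sequentially sequentially"
    using r by (rule filterlim_subseq)
  have bound: "(\<lambda>n. s + ennreal (1 / Suc (r n))) \<longlonglongrightarrow> s + ennreal 0"
  proof (intro tendsto_add tendsto_const tendsto_ennrealI)
    show "(\<lambda>n. 1 / real (Suc (r n))) \<longlonglongrightarrow> 0"
      by (rule filterlim_compose[OF _ r_top, of "\<lambda>n. 1 / real (Suc n)"]) real_asymp
  qed
  \<comment> \<open>Fatou's lemma along the subsequence, with the pointwise limit \<open>f\<close> still to be identified.\<close>
  have key: "(\<integral>\<^sup>+ z. f z \<partial>Q) \<le> s"
    if f: "AE z in Q. (\<lambda>n. ennreal (\<rho> (a (r n) / W z))) \<longlonglongrightarrow> f z" for f
  proof -
    have "(\<integral>\<^sup>+ z. f z \<partial>Q) =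
        (\<integral>\<^sup>+ z. liminf (\<lambda>n. indicator (S (r n)) z * ennreal (\<rho> (a (r n) / W z))) \<partial>Q)"
    proof (rule nn_integral_cong_AE, use f exhaust in eventually_elim)
      case (elim z)
      have "\<forall>\<^sub>F n in sequentially. ennreal (\<rho> (a (r n) / W z)) =
          indicator (S (r n)) z * ennreal (\<rho> (a (r n) / W z))"
        using eventually_compose_filterlim[OF elim(2) r_top] by eventually_elim auto
      then have "(\<lambda>n. indicator (S (r n)) z * ennreal (\<rho> (a (r n) / W z))) \<longlonglongrightarrow> f z"
        using elim(1) by (rule Lim_transform_eventually[rotated])
      then show ?case by (intro lim_imp_Liminf[symmetric]) auto
    qed
    also have "\<dots> \<le> liminf (\<lambda>n. \<integral>\<^sup>+ z. indicator (S (r n)) z * ennreal (\<rho> (a (r n) / W z)) \<partial>Q)"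
      by (rule nn_integral_liminf) auto
    also have "\<dots> \<le> liminf (\<lambda>n. s + ennreal (1 / Suc (r n)))"
      by (intro Liminf_mono always_eventually allI less_imp_le a)
    also have "\<dots> = s"
      using lim_imp_Liminf[OF _ bound] by simp
    finally show ?thesis .
  qed
  consider "l = 0" | "l = \<infinity>" | x where "l = ennreal x" "x > 0"
    by (cases l) (auto simp: less_le)
  then show ?thesis
  proof cases
    case 1
    have a0: "filterlim (\<lambda>n. a (r n)) (at_right 0) sequentially"
    proof -
      have "(\<lambda>n. ennreal (a (r n))) \<longlonglongrightarrow> ennreal 0" using l 1 by simp
      then have "(\<lambda>n. a (r n)) \<longlonglongrightarrow> 0"
        using apos by (subst (asm) tendsto_ennreal_iff) (auto intro!: always_eventually less_imp_le)
      then show ?thesis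
        using apos by (auto simp: filterlim_at anz intro!: always_eventually)
    qed
    have "AE z in Q. (\<lambda>n. ennreal (\<rho> (a (r n) / W z))) \<longlonglongrightarrow> c\<^sub>0"
      using Wpos
    proof eventually_elim
      case (elim z)
      have "filterlim (\<lambda>n. a (r n) / W z) (at_right 0) sequentially"
      proof -
        have "(\<lambda>n. a (r n) / W z) \<longlonglongrightarrow> 0 / W z"
          using a0 elim by (intro tendsto_divide tendsto_const) (auto simp: filterlim_at)
        then show ?thesis
          using apos elim by (auto simp: filterlim_at anz intro!: always_eventually)
      qed
      then show ?case by (rule filterlim_compose[OF lim0])
    qed
    then have "(\<integral>\<^sup>+ z. c\<^sub>0 \<partial>Q) \<le> s" by (rule key)
    then show ?thesis by (simp add: emeasure_space_1)
  next
    case 2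
    have a1: "filterlim (\<lambda>n. a (r n)) at_top sequentially"
      using l 2 by (simp add: ennreal_tendsto_top_eq_at_top)
    have "AE z in Q. (\<lambda>n. ennreal (\<rho> (a (r n) / W z))) \<longlonglongrightarrow> c\<^sub>1"
      using Wpos
    proof eventually_elim
      case (elim z)
      have "filterlim (\<lambda>n. (1 / W z) * a (r n)) at_top sequentially"
        using elim by (intro filterlim_tendsto_pos_mult_at_top[OF tendsto_const _ a1]) auto
      then show ?case
        by (intro filterlim_compose[OF lim1]) simp
    qed
    then have "(\<integral>\<^sup>+ z. c\<^sub>1 \<partial>Q) \<le> s" by (rule key)
    then show ?thesis by (simp add: emeasure_space_1)
  next
    case 3
    have ax: "(\<lambda>n. a (r n)) \<longlonglongrightarrow> x"
    proof -
      have "(\<lambda>n. ennreal (a (r n))) \<longlonglongrightarrow> ennreal x" using l 3 by simp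
      then show ?thesis
        using apos 3(2) by (subst (asm) tendsto_ennreal_iff) (auto intro!: always_eventually less_imp_le)
    qed
    have "AE z in Q. (\<lambda>n. ennreal (\<rho> (a (r n) / W z))) \<longlonglongrightarrow> ennreal (\<rho> (x / W z))"
      using Wpos
    proof eventually_elim
      case (elim z)
      have *: "(\<lambda>n. a (r n) / W z) \<longlonglongrightarrow> x / W z"
        using ax elim by (intro tendsto_divide tendsto_const) auto
      have "isCont \<rho> (x / W z)"
        using cont elim 3(2) by (auto simp: continuous_on_eq_continuous_at)
      from isCont_tendsto_compose[OF this *] show ?case
        by (intro tendsto_ennrealI) simp
    qed
    then have "(\<integral>\<^sup>+ z. ennreal (\<rho> (x / W z)) \<partial>Q) \<le> s" by (rule key)
    then show ?thesis using 3(2) by blast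
  qed
qed

section \<open>Averaging the risk over large balls\<close>

text \<open>The supremum risk dominates the average risk over the ball of radius \<open>R + M\<close>. After
  exchanging the integrals, every \<open>x\<close> in the ball of radius \<open>R\<close> contributes at least the left-hand side,
  because the ball of radius \<open>M\<close> around \<open>x\<close> stays inside. The boundary layer has a vanishing share
  of the volume as \<open>R\<close> tends to infinity, so no factor is lost.\<close>
lemma truncated_Bayes_bound:
  fixes \<beta> \<rho> :: "real \<Rightarrow> real" and \<delta> :: "real^'n::finite \<Rightarrow> real" and M :: real
  assumes mono: "strict_mono_on {0..} \<beta>"
    and meas [measurable]: "\<rho> \<in> borel_measurable borel"
    and \<delta>: "\<delta> \<in> estimators" and M: "M \<ge> 0"
  shows "(INF a\<in>{0<..}. \<integral>\<^sup>+ z. indicator (ball 0 M) z *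
            ennreal (\<rho> (a / \<beta> ((norm z)\<^sup>2 / \<sigma>\<^sup>2))) \<partial>mvn (0 :: real^'n) \<sigma>)
         \<le> sup_risk \<sigma> \<beta> \<rho> \<delta>" (is "?I \<le> ?s")
proof -
  define W where "W = (\<lambda>z::real^'n. \<beta> ((norm z)\<^sup>2 / \<sigma>\<^sup>2))"
  have [measurable]: "W \<in> borel_measurable borel"
    unfolding W_def by (rule borel_measurable_loss_of_norm[OF mono])
  have [measurable]: "\<delta> \<in> borel_measurable borel" and \<delta>pos: "\<And>x. \<delta> x > 0"
    using \<delta> by (auto simp: estimators_def)
  have [measurable]: "ball (0::real^'n) r \<in> sets borel" for r by simp
  define K where "K = (\<lambda>x \<theta>. ennreal (mvn_density 0 \<sigma> (x - \<theta>)) * ennreal (\<rho> (\<delta> x / W (x - \<theta>))))"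
  have [measurable]: "case_prod K \<in> borel_measurable (lborel \<Otimes>\<^sub>M lborel)"
    unfolding K_def by measurable
  have risk: "risk \<sigma> \<beta> \<rho> \<theta> \<delta> = (\<integral>\<^sup>+ x. K x \<theta> \<partial>lborel)" for \<theta>
  proof -
    have "risk \<sigma> \<beta> \<rho> \<theta> \<delta> = (\<integral>\<^sup>+ x. ennreal (\<rho> (\<delta> x / W (x - \<theta>))) \<partial>mvn \<theta> \<sigma>)"
      by (simp add: risk_def first_loss_def W_def)
    also have "\<dots> = (\<integral>\<^sup>+ x. K x \<theta> \<partial>lborel)"
      by (subst nn_integral_mvn) (auto simp: K_def mvn_density_translate[of \<theta>])
    finally show ?thesis .
  qed
  \<comment> \<open>Here \<open>\<theta>\<close> varies around \<open>x\<close>, so the pivot is \<open>x - \<theta>\<close> and the reflection symmetry of the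
      integrand is needed.\<close>
  have local: "?I \<le> (\<integral>\<^sup>+ \<theta>. indicator (ball x M) \<theta> * K x \<theta> \<partial>lborel)" for x
  proof -
    define g where "g = (\<lambda>z::real^'n. ennreal (mvn_density 0 \<sigma> z) *
                          (indicator (ball 0 M) z * ennreal (\<rho> (\<delta> x / W z))))"
    have even: "g (- z) = g z" for z
      by (simp add: g_def W_def mvn_density_def normal_density_def indicator_def)
    have "?I \<le> (\<integral>\<^sup>+ z. indicator (ball 0 M) z * ennreal (\<rho> (\<delta> x / W z)) \<partial>mvn 0 \<sigma>)"
      unfolding W_def by (rule INF_lower) (simp add: \<delta>pos)
    also have "\<dots> = (\<integral>\<^sup>+ z. g z \<partial>lborel)"
      unfolding g_def by (rule nn_integral_mvn) measurable
    also have "\<dots> = (\<integral>\<^sup>+ \<theta>. g (\<theta> - x) \<partial>lborel)"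
      by (rule nn_integral_lborel_translate[symmetric]) (unfold g_def, measurable)
    also have "\<dots> = (\<integral>\<^sup>+ \<theta>. indicator (ball x M) \<theta> * K x \<theta> \<partial>lborel)"
    proof (rule nn_integral_cong)
      fix \<theta>
      have "g (\<theta> - x) = g (x - \<theta>)" using even[of "\<theta> - x"] by simp
      then show "g (\<theta> - x) = indicator (ball x M) \<theta> * K x \<theta>"
        by (simp add: g_def K_def indicator_def dist_norm)
    qed
    finally show ?thesis .
  qed
  define v where "v = unit_ball_vol (real DIM(real^'n))"
  define d where "d = DIM(real^'n)"
  have v: "v > 0" unfolding v_def by simp
  have vol: "emeasure lborel (ball (0::real^'n) R) = ennreal (v * R ^ d)" if "R \<ge> 0" for R
    unfolding v_def d_def by (rule emeasure_ball[OF that])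
  have scaled: "?I * ennreal (R ^ d) \<le> ?s * ennreal ((R + M) ^ d)" if R: "R > 0" for R
  proof -
    have "?I * emeasure lborel (ball (0::real^'n) R) = (\<integral>\<^sup>+ x. ?I * indicator (ball 0 R) (x::real^'n) \<partial>lborel)"
      by (rule nn_integral_cmult_indicator[symmetric]) simp
    also have "\<dots> \<le> (\<integral>\<^sup>+ x. (\<integral>\<^sup>+ \<theta>. indicator (ball 0 (R + M)) \<theta> * K x \<theta> \<partial>lborel) \<partial>lborel)"
    proof (rule nn_integral_mono)
      fix x :: "real^'n"
      show "?I * indicator (ball 0 R) x \<le> (\<integral>\<^sup>+ \<theta>. indicator (ball 0 (R + M)) \<theta> * K x \<theta> \<partial>lborel)"
      proof (cases "x \<in> ball 0 R")
        case True
        then have sub: "ball x M \<subseteq> ball 0 (R + M)"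
          by (intro ball_subset_ball_iff[THEN iffD2]) (auto simp: dist_commute)
        have "?I \<le> (\<integral>\<^sup>+ \<theta>. indicator (ball x M) \<theta> * K x \<theta> \<partial>lborel)" by (rule local)
        also have "\<dots> \<le> (\<integral>\<^sup>+ \<theta>. indicator (ball 0 (R + M)) \<theta> * K x \<theta> \<partial>lborel)"
          using sub by (intro nn_integral_mono mult_right_mono) (auto simp: indicator_def)
        finally show ?thesis using True by simp
      qed simp
    qed
    also have "\<dots> = (\<integral>\<^sup>+ \<theta>. (\<integral>\<^sup>+ x. indicator (ball 0 (R + M)) \<theta> * K x \<theta> \<partial>lborel) \<partial>lborel)"
      by (rule lborel_pair.Fubini') measurable
    also have "\<dots> = (\<integral>\<^sup>+ \<theta>. indicator (ball 0 (R + M)) \<theta> * risk \<sigma> \<beta> \<rho> \<theta> \<delta> \<partial>lborel)"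
      unfolding risk by (intro nn_integral_cong nn_integral_cmult) measurable
    also have "\<dots> \<le> (\<integral>\<^sup>+ \<theta>. ?s * indicator (ball 0 (R + M)) (\<theta>::real^'n) \<partial>lborel)"
      unfolding sup_risk_def
      by (intro nn_integral_mono) (auto simp: indicator_def intro: SUP_upper)
    also have "\<dots> = ?s * emeasure lborel (ball (0::real^'n) (R + M))"
      by (rule nn_integral_cmult_indicator) simp
    finally have "?I * (ennreal v * ennreal (R ^ d)) \<le> ?s * (ennreal v * ennreal ((R + M) ^ d))"
      using R M v by (simp add: vol ennreal_mult)
    then have "ennreal v * (?I * ennreal (R ^ d)) \<le> ennreal v * (?s * ennreal ((R + M) ^ d))"
      by (simp add: mult_ac)
    then show ?thesis
      using v by (subst (asm) ennreal_mult_le_mult_iff) auto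
  qed
  have "?I \<le> ?s * ennreal ((1 + M / R) ^ d)" if R: "R > 0" for R
  proof -
    have "ennreal (R ^ d) * ?I \<le> ennreal (R ^ d) * (?s * ennreal ((1 + M / R) ^ d))"
    proof -
      have "(R + M) ^ d = R ^ d * (1 + M / R) ^ d"
        using R by (simp add: power_mult_distrib[symmetric] field_simps)
      then show ?thesis
        using scaled[OF R] R M by (simp add: ennreal_mult mult_ac)
    qed
    then show ?thesis using R by (subst (asm) ennreal_mult_le_mult_iff) auto
  qed
  moreover have "((\<lambda>R. ?s * ennreal ((1 + M / R) ^ d)) \<longlongrightarrow> ?s * ennreal ((1 + 0) ^ d)) at_top"
  proof (intro tendsto_mult_ennreal tendsto_ennrealI tendsto_power tendsto_add tendsto_const)
    show "((\<lambda>R. M / R) \<longlongrightarrow> 0) at_top" by real_asymp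
  qed auto
  ultimately have "?I \<le> ?s * ennreal ((1 + 0) ^ d)"
    by (intro tendsto_lowerbound[where F = at_top])
       (auto intro: eventually_mono[OF eventually_gt_at_top[of "0::real"]])
  then show ?thesis by simp
qed

section \<open>Minimaxity for midpoint-convex losses\<close>

text \<open>The last condition on \<open>\<rho>\<close> is midpoint convexity with one of the two points at an end
  \<open>0\<close> or \<open>\<infinity>\<close> of the half-line where \<open>\<rho>\<close> has the finite limit \<open>c\<close>. It bounds the minimal criterion by
  \<open>c\<close>: near-minimizers of truncated problems that escape to that end then cost at least as much as
  the Bayes value.\<close>
lemma minimax_of_midpoint_convex_loss:
  fixes \<beta> \<rho> :: "real \<Rightarrow> real" and \<delta> :: "real^'n::finite \<Rightarrow> real"
  assumes \<sigma>: "\<sigma> > 0" and nonneg: "\<And>t. t \<ge> 0 \<Longrightarrow> \<beta> t \<ge> 0" and mono: "strict_mono_on {0..} \<beta>"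
    and meas [measurable]: "\<rho> \<in> borel_measurable borel" and \<rho>: "\<And>t. t > 0 \<Longrightarrow> \<rho> t \<ge> 0"
    and cont: "continuous_on {0<..} \<rho>"
    and mid: "\<And>a b. a > 0 \<Longrightarrow> b > 0 \<Longrightarrow> a \<noteq> b \<Longrightarrow>
               \<exists>c>0. \<forall>w>0. 2 * \<rho> (c / w) < \<rho> (a / w) + \<rho> (b / w)"
    and lim0: "((\<lambda>t. ennreal (\<rho> t)) \<longlongrightarrow> c\<^sub>0) (at_right 0)"
    and lim1: "((\<lambda>t. ennreal (\<rho> t)) \<longlongrightarrow> c\<^sub>1) at_top"
    and half: "\<And>a c. a > 0 \<Longrightarrow> c \<in> {c\<^sub>0, c\<^sub>1} \<Longrightarrow> c \<noteq> \<infinity> \<Longrightarrow>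
               \<exists>b>0. \<forall>w>0. 2 * ennreal (\<rho> (b / w)) \<le> ennreal (\<rho> (a / w)) + c"
    and Bayes: "generalized_Bayes \<sigma> \<beta> \<rho> (\<lambda>_. 1) \<delta>"
  shows "minimax \<sigma> \<beta> \<rho> \<delta> \<and>
         (\<exists>r. (\<forall>\<theta>. risk \<sigma> \<beta> \<rho> \<theta> \<delta> = r) \<and> r = minimax_risk TYPE('n) \<sigma> \<beta> \<rho>)"
proof -
  define h where "h = (\<lambda>a. risk \<sigma> \<beta> \<rho> (0::real^'n) (\<lambda>_. a))"
  have \<delta>: "\<delta> \<in> estimators" and \<delta>pos: "\<And>x. \<delta> x > 0"
    and fin: "\<And>x. h (\<delta> x) < \<infinity>" and min: "\<And>x a. a > 0 \<Longrightarrow> h (\<delta> x) \<le> h a"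
    using Bayes
    by (auto simp: generalized_Bayes_def estimators_def posterior_loss_uniform[OF \<sigma> mono meas] h_def)
  define a where "a = \<delta> 0"
  have const: "\<delta> = (\<lambda>_. a)"
  proof
    fix x
    show "\<delta> x = a"
      using unique_minimizer[where 'n = 'n, OF \<sigma> nonneg mono meas \<rho> mid \<delta>pos \<delta>pos, of x 0]
        fin min unfolding h_def a_def by blast
  qed
  have risk: "risk \<sigma> \<beta> \<rho> \<theta> \<delta> = h a" for \<theta>
    unfolding const h_def by (rule risk_constant_estimator[OF mono meas])
  have a: "a > 0" "h a < \<infinity>" "\<And>b. b > 0 \<Longrightarrow> h a \<le> h b"
    using \<delta>pos fin min by (auto simp: a_def)
  have sup: "sup_risk \<sigma> \<beta> \<rho> \<delta> = h a"
    by (simp add: sup_risk_def risk)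

  define Q :: "(real^'n) measure" where "Q = mvn 0 \<sigma>"
  define W where "W = (\<lambda>z::real^'n. \<beta> ((norm z)\<^sup>2 / \<sigma>\<^sup>2))"
  interpret prob_space Q unfolding Q_def by (rule prob_space_mvn[OF \<sigma>])
  have [measurable_cong]: "sets Q = sets borel" by (simp add: Q_def sets_mvn)
  have [measurable]: "W \<in> borel_measurable borel"
    unfolding W_def by (rule borel_measurable_loss_of_norm[OF mono])
  have h: "h e = (\<integral>\<^sup>+ z. ennreal (\<rho> (e / W z)) \<partial>Q)" for e
    by (simp add: h_def risk_def first_loss_def Q_def W_def)
  have Wpos: "AE z in Q. W z > 0"
    unfolding Q_def W_def by (rule AE_loss_positive[OF \<sigma> nonneg mono])

  have ends: "h a \<le> c" if c: "c \<in> {c\<^sub>0, c\<^sub>1}" for c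
  proof (cases "c = \<infinity>")
    case False
    obtain b where b: "b > 0" "\<And>w. w > 0 \<Longrightarrow> 2 * ennreal (\<rho> (b / w)) \<le> ennreal (\<rho> (a / w)) + c"
      using half[OF a(1) c False] by blast
    have "2 * h a \<le> 2 * h b" using a(3)[OF b(1)] by (intro mult_left_mono) auto
    also have "\<dots> = (\<integral>\<^sup>+ z. 2 * ennreal (\<rho> (b / W z)) \<partial>Q)"
      unfolding h by (rule nn_integral_cmult[symmetric]) auto
    also have "\<dots> \<le> (\<integral>\<^sup>+ z. ennreal (\<rho> (a / W z)) + c \<partial>Q)"
      by (rule nn_integral_mono_AE) (use Wpos in eventually_elim, auto intro: b)
    also have "\<dots> = h a + c"
      unfolding h by (subst nn_integral_add) (auto simp: emeasure_space_1)
    finally have "h a + h a \<le> h a + c" by (simp add: mult_2)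
    then show ?thesis using a(2) by (auto simp: ennreal_add_left_cancel_le)
  qed simp

  have lower: "h a \<le> sup_risk \<sigma> \<beta> \<rho> \<delta>'" if \<delta>': "\<delta>' \<in> estimators" for \<delta>' :: "real^'n \<Rightarrow> real"
  proof (cases "sup_risk \<sigma> \<beta> \<rho> \<delta>' < \<infinity>")
    case True
    define s where "s = sup_risk \<sigma> \<beta> \<rho> \<delta>'"
    have exh: "AE z in Q. \<forall>\<^sub>F n in sequentially. z \<in> ball 0 (real n)"
    proof (rule AE_I2)
      fix z :: "real^'n"
      show "\<forall>\<^sub>F n in sequentially. z \<in> ball 0 (real n)"
        using eventually_compose_filterlim[OF eventually_gt_at_top[of "norm z"] filterlim_real_sequentially]
        by simp
    qed
    have "c\<^sub>0 \<le> s \<or> c\<^sub>1 \<le> s \<or> (\<exists>b>0. (\<integral>\<^sup>+ z. ennreal (\<rho> (b / W z)) \<partial>Q) \<le> s)"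
    proof (rule truncated_minimizers_limit[OF prob_space_axioms _ meas _ Wpos exh cont lim0 lim1])
      show "(INF b\<in>{0<..}. \<integral>\<^sup>+ z. indicator (ball 0 (real n)) z * ennreal (\<rho> (b / W z)) \<partial>Q) \<le> s" for n
        unfolding s_def Q_def W_def by (rule truncated_Bayes_bound[OF mono meas \<delta>']) simp
      show "s < \<infinity>" using True by (simp add: s_def)
    qed auto
    then show ?thesis
      using ends[of c\<^sub>0] ends[of c\<^sub>1] a(3) unfolding h[symmetric] s_def[symmetric]
      by (auto intro: order_trans)
  qed (simp add: less_top[symmetric])

  have "minimax_risk TYPE('n) \<sigma> \<beta> \<rho> = h a"
    unfolding minimax_risk_def
    by (rule antisym) (use \<delta> sup lower in \<open>auto intro!: INF_greatest intro: INF_lower2\<close>)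
  then show ?thesis
    using \<delta> risk sup by (auto simp: minimax_def)
qed

section \<open>The three second-stage losses\<close>

text \<open>\<open>\<rho>\<^sub>A\<close> is a quadratic polynomial in \<open>t\<^sup>m\<close>, so the midpoint is taken between the \<open>m\<close>-th
  powers.\<close>
lemma rho_A_midpoint:
  assumes m: "m \<noteq> 0" and "a > 0" "b > 0" "a \<noteq> b"
  shows "\<exists>c>0. \<forall>w>0. 2 * rho_A m (c / w) < rho_A m (a / w) + rho_A m (b / w)"
proof (intro exI conjI allI impI)
  let ?c = "((a powr m + b powr m) / 2) powr (1 / m)"
  have "a powr m + b powr m > 0" using assms by (simp add: add_pos_pos)
  then show "?c > 0" by simp
  fix w :: real assume w: "w > 0"
  define x y where "x = (a / w) powr m" and "y = (b / w) powr m"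
  have "x \<noteq> y"
  proof
    assume "x = y"
    then have "x powr (1 / m) = y powr (1 / m)" by simp
    then show False using assms w by (simp add: x_def y_def powr_powr)
  qed
  have "?c powr m = (a powr m + b powr m) / 2"
    using m \<open>a powr m + b powr m > 0\<close> by (simp add: powr_powr)
  then have mid: "(?c / w) powr m = (x + y) / 2"
    using assms w by (simp add: x_def y_def powr_divide add_divide_distrib)
  show "2 * rho_A m (?c / w) < rho_A m (a / w) + rho_A m (b / w)"
  proof -
    have "0 < (x - y)\<^sup>2" using \<open>x \<noteq> y\<close> by simp
    then show ?thesis
      unfolding rho_A_def mid x_def[symmetric] y_def[symmetric]
      by (simp add: power2_eq_square field_simps)
  qed
qed

text \<open>The midpoint in the coordinate \<open>t\<^sup>m\<close> between \<open>a\<close> and the end where \<open>t\<^sup>m = 0\<close>; that end is \<open>0\<close>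
  for positive and \<open>\<infinity>\<close> for negative \<open>m\<close>.\<close>
lemma rho_A_half:
  assumes m: "m \<noteq> 0" and "a > 0"
  shows "\<exists>b>0. \<forall>w>0. 2 * ennreal (rho_A m (b / w)) \<le> ennreal (rho_A m (a / w)) + 1"
proof (intro exI conjI allI impI)
  let ?b = "a * (1 / 2) powr (1 / m)"
  show "?b > 0" using assms by simp
  fix w :: real assume w: "w > 0"
  define x where "x = (a / w) powr m"
  have b: "(?b / w) powr m = x / 2"
    using assms w by (simp add: x_def powr_divide powr_mult powr_powr)
  have "2 * rho_A m (?b / w) \<le> rho_A m (a / w) + 1"
    unfolding rho_A_def b x_def[symmetric] by (simp add: power2_eq_square field_simps)
  then have "ennreal (2 * rho_A m (?b / w)) \<le> ennreal (rho_A m (a / w) + 1)"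
    by (rule ennreal_leI)
  then show "2 * ennreal (rho_A m (?b / w)) \<le> ennreal (rho_A m (a / w)) + 1"
    by (simp add: ennreal_mult rho_A_def)
qed

text \<open>With the arithmetic mean as midpoint the linear terms of \<open>\<rho>\<^sub>B\<close> cancel, and what is left is the
  strict convexity of \<open>1 / t\<close>.\<close>
lemma rho_B_midpoint:
  assumes "a > 0" "b > 0" "a \<noteq> b"
  shows "\<exists>c>0. \<forall>w>0. 2 * rho_B (c / w) < rho_B (a / w) + rho_B (b / w)"
proof (intro exI conjI allI impI)
  let ?c = "(a + b) / 2"
  show "?c > 0" using assms by simp
  fix w :: real assume w: "w > 0"
  have "0 < (a - b)\<^sup>2" using assms by simp
  then have "2 / ?c < 1 / a + 1 / b"
    using assms by (simp add: field_simps power2_eq_square)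
  then have less: "2 / ?c * w < (1 / a + 1 / b) * w" using w by (rule mult_strict_right_mono)
  have mid: "2 * rho_B (?c / w) = (a + b) / (2 * w) + (2 / ?c * w) / 2 - 2"
    using assms w add_pos_pos[of a b]
    by (simp add: rho_B_def field_simps)
  have ends: "rho_B (a / w) + rho_B (b / w) = (a + b) / (2 * w) + ((1 / a + 1 / b) * w) / 2 - 2"
    by (simp add: rho_B_def add_divide_distrib diff_divide_distrib distrib_right)
  show "2 * rho_B (?c / w) < rho_B (a / w) + rho_B (b / w)"
    unfolding mid ends
    by (intro diff_strict_right_mono add_strict_left_mono divide_strict_right_mono less) simp
qed

text \<open>\<open>\<rho>\<^sub>C\<close> is quadratic in \<open>ln t\<close>, so the midpoint is the geometric mean.\<close>
lemma rho_C_midpoint: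
  assumes "a > 0" "b > 0" "a \<noteq> b"
  shows "\<exists>c>0. \<forall>w>0. 2 * rho_C (c / w) < rho_C (a / w) + rho_C (b / w)"
proof (intro exI conjI allI impI)
  let ?c = "sqrt (a * b)"
  show "?c > 0" using assms by simp
  fix w :: real assume w: "w > 0"
  have c: "ln (?c / w) = (ln (a / w) + ln (b / w)) / 2"
    using assms w by (simp add: ln_div ln_sqrt ln_mult field_simps)
  have "ln (a / w) \<noteq> ln (b / w)" using assms w by simp
  then have "0 < (ln (a / w) - ln (b / w))\<^sup>2" by simp
  then show "2 * rho_C (?c / w) < rho_C (a / w) + rho_C (b / w)"
    unfolding rho_C_def c by (simp add: power2_eq_square field_simps)
qed

lemma rho_A_tendsto_one:
  assumes "((\<lambda>t::real. t powr m) \<longlongrightarrow> 0) F"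
  shows "((\<lambda>t. ennreal (rho_A m t)) \<longlongrightarrow> 1) F"
proof -
  have "((\<lambda>t. ennreal (rho_A m t)) \<longlongrightarrow> ennreal ((0 - 1)\<^sup>2)) F"
    unfolding rho_A_def by (intro tendsto_intros assms)
  then show ?thesis by simp
qed

lemma tendsto_ennreal_top: "filterlim f at_top F \<Longrightarrow> ((\<lambda>x. ennreal (f x)) \<longlongrightarrow> \<infinity>) F"
  by (simp add: ennreal_tendsto_top_eq_at_top)

section \<open>Minimaxity of the generalized Bayes estimator of loss\<close>

theorem theorem5:
  fixes \<sigma> m :: real
    and \<beta> \<rho> :: "real \<Rightarrow> real"
    and \<delta> :: "real ^ 'n::finite \<Rightarrow> real"
  assumes "\<sigma> > 0"
    and "\<And>t. t \<ge> 0 \<Longrightarrow> \<beta> t \<ge> 0"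
    and "abs_cont_halfline \<beta>"
    and "strict_mono_on {0..} \<beta>"
    and "set_integrable (chi_square CARD('n)) {0..} \<beta>"
    and "m \<noteq> 0"
    and "\<rho> \<in> {rho_A m, rho_B, rho_C}"
    and "generalized_Bayes \<sigma> \<beta> \<rho> (\<lambda>_. 1) \<delta>"
    and "\<And>\<theta>. risk \<sigma> \<beta> \<rho> \<theta> \<delta> < \<infinity>"
  shows "minimax \<sigma> \<beta> \<rho> \<delta> \<and>
         (\<exists>r. (\<forall>\<theta>. risk \<sigma> \<beta> \<rho> \<theta> \<delta> = r) \<and> r = minimax_risk TYPE('n) \<sigma> \<beta> \<rho>)"
proof -
  consider "\<rho> = rho_A m" "m > 0" | "\<rho> = rho_A m" "m < 0" | "\<rho> = rho_B" | "\<rho> = rho_C"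
    using assms(6,7) by fastforce
  then show ?thesis
  proof cases
    case 1
    have lim0: "((\<lambda>t. ennreal (\<rho> t)) \<longlongrightarrow> 1) (at_right 0)"
      unfolding 1(1) by (rule rho_A_tendsto_one) (use 1(2) in real_asymp)
    have lim1: "((\<lambda>t. ennreal (\<rho> t)) \<longlongrightarrow> \<infinity>) at_top"
      unfolding 1(1) rho_A_def by (rule tendsto_ennreal_top) (use 1(2) in real_asymp)
    show ?thesis
    proof (rule minimax_of_midpoint_convex_loss[OF assms(1) _ assms(4) _ _ _ _ lim0 lim1 _ assms(8)])
      show "\<rho> \<in> borel_measurable borel" unfolding 1(1) rho_A_def by measurable
      show "continuous_on {0<..} \<rho>" unfolding 1(1) rho_A_def by (auto intro!: continuous_intros)
      show "\<rho> t \<ge> 0" for t by (simp add: 1 rho_A_def)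
    qed (use 1 assms(2,6) rho_A_midpoint rho_A_half in auto)
  next
    case 2
    have lim0: "((\<lambda>t. ennreal (\<rho> t)) \<longlongrightarrow> \<infinity>) (at_right 0)"
      unfolding 2(1) rho_A_def by (rule tendsto_ennreal_top) (use 2(2) in real_asymp)
    have lim1: "((\<lambda>t. ennreal (\<rho> t)) \<longlongrightarrow> 1) at_top"
      unfolding 2(1) by (rule rho_A_tendsto_one) (use 2(2) in real_asymp)
    show ?thesis
    proof (rule minimax_of_midpoint_convex_loss[OF assms(1) _ assms(4) _ _ _ _ lim0 lim1 _ assms(8)])
      show "\<rho> \<in> borel_measurable borel" unfolding 2(1) rho_A_def by measurable
      show "continuous_on {0<..} \<rho>" unfolding 2(1) rho_A_def by (auto intro!: continuous_intros)
      show "\<rho> t \<ge> 0" for t by (simp add: 2 rho_A_def)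
    qed (use 2 assms(2,6) rho_A_midpoint rho_A_half in auto)
  next
    case 3
    have lim0: "((\<lambda>t. ennreal (\<rho> t)) \<longlongrightarrow> \<infinity>) (at_right 0)"
      unfolding 3 rho_B_def by (rule tendsto_ennreal_top) real_asymp
    have lim1: "((\<lambda>t. ennreal (\<rho> t)) \<longlongrightarrow> \<infinity>) at_top"
      unfolding 3 rho_B_def by (rule tendsto_ennreal_top) real_asymp
    show ?thesis
    proof (rule minimax_of_midpoint_convex_loss[OF assms(1) _ assms(4) _ _ _ _ lim0 lim1 _ assms(8)])
      show "\<rho> \<in> borel_measurable borel" unfolding 3 rho_B_def by measurable
      show "continuous_on {0<..} \<rho>" unfolding 3 rho_B_def by (auto intro!: continuous_intros)
      show "\<rho> t \<ge> 0" if "t > 0" for t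
      proof -
        have "0 \<le> (t - 1)\<^sup>2 / (2 * t)" using that by simp
        also have "\<dots> = \<rho> t" using that by (simp add: 3 rho_B_def field_simps power2_eq_square)
        finally show ?thesis .
      qed
    qed (use 3 assms(2) rho_B_midpoint in auto)
  next
    case 4
    have lim0: "((\<lambda>t. ennreal (\<rho> t)) \<longlongrightarrow> \<infinity>) (at_right 0)"
      unfolding 4 rho_C_def by (rule tendsto_ennreal_top) real_asymp
    have lim1: "((\<lambda>t. ennreal (\<rho> t)) \<longlongrightarrow> \<infinity>) at_top"
      unfolding 4 rho_C_def by (rule tendsto_ennreal_top) real_asymp
    show ?thesis
    proof (rule minimax_of_midpoint_convex_loss[OF assms(1) _ assms(4) _ _ _ _ lim0 lim1 _ assms(8)])
      show "\<rho> \<in> borel_measurable borel" unfolding 4 rho_C_def by measurable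
      show "continuous_on {0<..} \<rho>" unfolding 4 rho_C_def by (auto intro!: continuous_intros)
    qed (use 4 assms(2) rho_C_midpoint in \<open>auto simp: rho_C_def\<close>)
  qed
qed

end
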